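(* Let $\Gamma=(G,\sigma)$ be a signed graph with $m$ vertices and let $\Gamma'=\Gamma-e$ be the signed graph obtained from $\Gamma$ by removing an edge $e$ with $\sigma(e)=-$. If $(\alpha_1,\dots,\alpha_m)$ and $(\beta_1,\dots,\beta_m)$ are the ordered net-Laplacian spectra of $\Gamma$ and $\Gamma'$ respectively, then \[ \alpha_p\leqslant\beta_p\leqslant\alpha_{p+1}\quad\text{for } p=1,2,\dots,m, \] with the convention that $\alpha_{m+1}=m$.
   Context: A signed graph $(G,\sigma)$ consists of a finite simple undirected graph $G$ and a map $\sigma:E(G)\to\{+1,-1\}$. The adjacency matrix $A(\Gamma)$ has $(l,k)$ entry $\sigma(u_lu_k)$ if $u_l,u_k$ are adjacent and $0$ otherwise. For a vertex $u$, $d_u^+$, $d_u^-$ are the numbers of positive and negative edges at $u$ and $\mathrm{sdeg}(u)=d_u^+-d_u^-$. The net-Laplacian is $N(\Gamma)=D^{\pm}(\Gamma)-A(\Gamma)$ with $D^{\pm}(\Gamma)=\mathrm{diag}(\mathrm{sdeg}(u_1),\dots,\mathrm{sdeg}(u_m))$. The ordered spectrum is the list of eigenvalues with multiplicity in non-decreasing order. Removing an edge keeps the signs of all other edges. *)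

theory Defs
  imports "Jordan_Normal_Form.Char_Poly"
begin

text \<open>An edge is the two-element set of its end vertices, so an undirected graph without loops
  and multiple edges is given by a set of such sets. The sign function is total on sets of
  vertices; only its values on edges are relevant.\<close>

record 'a sgraph =
  verts :: "'a set"
  edges :: "'a set set"
  sgn_of :: "'a set \<Rightarrow> int"

definition signed_graph :: "'a sgraph \<Rightarrow> bool" where
  "signed_graph \<Gamma> \<longleftrightarrow>
     finite (verts \<Gamma>) \<and>
     (\<forall>e \<in> edges \<Gamma>. e \<subseteq> verts \<Gamma> \<and> card e = 2) \<and>
     (\<forall>e \<in> edges \<Gamma>. sgn_of \<Gamma> e \<in> {1, - 1})"

definition remove_edge :: "'a sgraph \<Rightarrow> 'a set \<Rightarrow> 'a sgraph" where
  "remove_edge \<Gamma> e = \<Gamma>\<lparr>edges := edges \<Gamma> - {e}\<rparr>"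

lemma signed_graph_remove_edge: "signed_graph \<Gamma> \<Longrightarrow> signed_graph (remove_edge \<Gamma> e)"
  by (simp add: signed_graph_def remove_edge_def)

definition pos_deg :: "'a sgraph \<Rightarrow> 'a \<Rightarrow> nat" where
  "pos_deg \<Gamma> u = card {e \<in> edges \<Gamma>. u \<in> e \<and> sgn_of \<Gamma> e = 1}"

definition neg_deg :: "'a sgraph \<Rightarrow> 'a \<Rightarrow> nat" where
  "neg_deg \<Gamma> u = card {e \<in> edges \<Gamma>. u \<in> e \<and> sgn_of \<Gamma> e = - 1}"

definition sdeg :: "'a sgraph \<Rightarrow> 'a \<Rightarrow> int" where
  "sdeg \<Gamma> u = int (pos_deg \<Gamma> u) - int (neg_deg \<Gamma> u)"

text \<open>Matrices are taken with respect to an enumeration \<open>us\<close> of the vertices; rows and columns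
  are indexed from 0.\<close>

definition enumerates :: "'a list \<Rightarrow> 'a sgraph \<Rightarrow> bool" where
  "enumerates us \<Gamma> \<longleftrightarrow> distinct us \<and> set us = verts \<Gamma>"

definition adj_matrix :: "'a sgraph \<Rightarrow> 'a list \<Rightarrow> real mat" where
  "adj_matrix \<Gamma> us = mat (length us) (length us) (\<lambda>(l, k).
     if {us ! l, us ! k} \<in> edges \<Gamma> then of_int (sgn_of \<Gamma> {us ! l, us ! k}) else 0)"

definition sdeg_matrix :: "'a sgraph \<Rightarrow> 'a list \<Rightarrow> real mat" where
  "sdeg_matrix \<Gamma> us = mat_diag (length us) (\<lambda>l. of_int (sdeg \<Gamma> (us ! l)))"

definition net_laplacian :: "'a sgraph \<Rightarrow> 'a list \<Rightarrow> real mat" where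
  "net_laplacian \<Gamma> us = sdeg_matrix \<Gamma> us - adj_matrix \<Gamma> us"

text \<open>The eigenvalues, each repeated according to its multiplicity as a root of the
  characteristic polynomial, in non-decreasing order. Only real roots are listed, which for a
  symmetric matrix are all of them.\<close>

definition ordered_spectrum :: "real mat \<Rightarrow> real list" where
  "ordered_spectrum A = sorted_list_of_multiset (proots (char_poly A))"

end

theory Submission
  imports Defs
begin

text \<open>The quadratic form of the net-Laplacian is the sum of \<open>\<sigma>(uv) (x\<^sub>u - x\<^sub>v)\<^sup>2\<close> over the edges
  \<open>uv\<close>. Removing the negative edge \<open>e = uv\<close> therefore adds \<open>(x\<^sub>u - x\<^sub>v)\<^sup>2\<close>, which is nonnegative
  and vanishes on the hyperplane \<open>x\<^sub>u = x\<^sub>v\<close>. By the Courant--Fischer argument the first fact gives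
  \<open>\<alpha>\<^sub>p \<le> \<beta>\<^sub>p\<close> and the second \<open>\<beta>\<^sub>p \<le> \<alpha>\<^bsub>p+1\<^esub>\<close>; comparison with the complete graph gives
  \<open>\<beta>\<^sub>m \<le> m\<close>. The spectral theorem for real symmetric matrices is obtained by deflation with
  Householder reflections.\<close>

section \<open>Symmetric matrices and coordinate formulas\<close>

definition symmetric_mat :: "'a mat \<Rightarrow> bool" where
  "symmetric_mat A \<longleftrightarrow> transpose_mat A = A"

lemma symmetric_mat_index:
  assumes "symmetric_mat A" "A \<in> carrier_mat n n" "i < n" "j < n"
  shows "A $$ (i, j) = A $$ (j, i)"
proof -
  have "transpose_mat A $$ (i, j) = A $$ (j, i)"
    using assms by (intro index_transpose_mat) auto
  with assms(1) show ?thesis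
    by (simp add: symmetric_mat_def)
qed

lemma symmetric_matI:
  assumes "A \<in> carrier_mat n n" "\<And>i j. i < n \<Longrightarrow> j < n \<Longrightarrow> A $$ (i, j) = A $$ (j, i)"
  shows "symmetric_mat A"
  unfolding symmetric_mat_def using assms by (intro eq_matI) auto

lemma mult_mat_vec_index_sum:
  assumes "A \<in> carrier_mat n n" "v \<in> carrier_vec n" "i < n"
  shows "(A *\<^sub>v v) $ i = (\<Sum>j<n. A $$ (i, j) * v $ j)"
  using assms by (simp add: scalar_prod_def lessThan_atLeast0)

lemma scalar_prod_eq_sum:
  assumes "w \<in> carrier_vec n"
  shows "v \<bullet> w = (\<Sum>i<n. v $ i * w $ i)"
  using assms by (simp add: scalar_prod_def lessThan_atLeast0)

lemma scalar_prod_self_pos: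
  fixes v :: "real vec"
  assumes "v \<in> carrier_vec n" "v \<noteq> 0\<^sub>v n"
  shows "0 < v \<bullet> v"
proof -
  obtain i where "i < n" "v $ i \<noteq> 0"
    using assms by (metis carrier_vecD eq_vecI index_zero_vec)
  then have "0 < (\<Sum>i<n. v $ i * v $ i)"
    by (intro sum_pos2[of _ i]) (auto simp: zero_less_mult_iff)
  then show ?thesis
    by (simp add: scalar_prod_eq_sum[OF assms(1)])
qed

section \<open>Real spectrum of a symmetric matrix\<close>

text \<open>For an eigenvector \<open>v\<close> with eigenvalue \<open>z\<close>, the Hermitian form
  \<open>S\<close> of \<open>A\<close> at \<open>v\<close> equals \<open>z\<close> times the squared
  norm \<open>R\<close>. As \<open>A\<close> is real and symmetric, \<open>S\<close> is its own
  conjugate, and \<open>R\<close> is nonzero.\<close>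

lemma symmetric_mat_complex_root_real:
  fixes A :: "real mat"
  assumes A: "A \<in> carrier_mat n n" and sym: "symmetric_mat A"
    and z: "poly (char_poly (map_mat complex_of_real A)) z = 0"
  shows "z \<in> \<real>"
proof -
  let ?M = "map_mat complex_of_real A"
  have M: "?M \<in> carrier_mat n n"
    using A by simp
  obtain v where v: "v \<in> carrier_vec n" "v \<noteq> 0\<^sub>v n" "?M *\<^sub>v v = z \<cdot>\<^sub>v v"
    using z A by (auto simp: eigenvalue_root_char_poly[OF M, symmetric] eigenvalue_def
        eigenvector_def)
  define R where "R = (\<Sum>i<n. (cmod (v $ i))\<^sup>2)"
  define S where "S = (\<Sum>i<n. cnj (v $ i) * (\<Sum>j<n. of_real (A $$ (i, j)) * v $ j))"
  have "(\<Sum>j<n. complex_of_real (A $$ (i, j)) * v $ j) = z * v $ i" if "i < n" for i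
  proof -
    have "(\<Sum>j<n. complex_of_real (A $$ (i, j)) * v $ j) = (\<Sum>j<n. ?M $$ (i, j) * v $ j)"
      using A that by (intro sum.cong) auto
    also have "\<dots> = (?M *\<^sub>v v) $ i"
      using mult_mat_vec_index_sum[OF M v(1) that] by simp
    also have "\<dots> = z * v $ i"
      using v(1) that by (simp add: v(3))
    finally show ?thesis .
  qed
  then have "S = (\<Sum>i<n. z * of_real ((cmod (v $ i))\<^sup>2))"
    unfolding S_def
    by (intro sum.cong) (auto simp: complex_norm_square mult_ac simp del: of_real_power)
  then have S: "S = z * of_real R"
    by (simp add: R_def sum_distrib_left)
  have "S = (\<Sum>i<n. \<Sum>j<n. of_real (A $$ (i, j)) * (cnj (v $ i) * v $ j))"
    by (simp add: S_def sum_distrib_left mult_ac)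
  \<comment> \<open>The indices of \<open>A\<close> are exchanged by symmetry, so that swapping the
    two sums leads back to \<open>S\<close> up to renaming.\<close>
  moreover have "cnj S = (\<Sum>i<n. \<Sum>j<n. of_real (A $$ (j, i)) * (cnj (v $ j) * v $ i))"
    using symmetric_mat_index[OF sym A]
    by (simp add: S_def sum_distrib_left mult_ac)
  moreover have "\<dots> = (\<Sum>j<n. \<Sum>i<n. of_real (A $$ (j, i)) * (cnj (v $ j) * v $ i))"
    by (rule sum.swap)
  ultimately have "cnj S = S"
    by simp
  moreover have "R \<noteq> 0"
  proof
    assume "R = 0"
    then have "\<forall>i<n. v $ i = 0"
      by (simp add: R_def sum_nonneg_eq_0_iff)
    with v(1,2) show False
      by (metis carrier_vecD eq_vecI index_zero_vec)
  qed
  ultimately have "cnj z = z"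
    by (simp add: S)
  then show ?thesis
    by (simp add: Reals_cnj_iff)
qed

text \<open>The polynomial splits over the complex numbers with real roots only, and the embedding
  of real into complex polynomials is injective, so the factorization descends to the reals.\<close>

lemma symmetric_mat_char_poly_splits:
  fixes A :: "real mat"
  assumes A: "A \<in> carrier_mat n n" and sym: "symmetric_mat A"
  shows "\<exists>es. char_poly A = (\<Prod>e\<leftarrow>es. [:- e, 1:]) \<and> length es = n"
proof -
  interpret h: map_poly_inj_idom_hom complex_of_real ..
  obtain cs where cs: "char_poly (map_mat complex_of_real A) = (\<Prod>c\<leftarrow>cs. [:- c, 1:])"
    and len: "length cs = n"
    using char_poly_factorized[of "map_mat complex_of_real A" n] A by auto
  have "c \<in> \<real>" if "c \<in> set cs" for c
  proof (rule symmetric_mat_complex_root_real[OF A sym])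
    show "poly (char_poly (map_mat complex_of_real A)) c = 0"
      unfolding cs poly_prod_list using that by (auto simp: prod_list_zero_iff)
  qed
  then have real: "map complex_of_real (map Re cs) = cs"
    by (simp add: map_idI)
  have "map_poly complex_of_real (char_poly A) = (\<Prod>c\<leftarrow>map complex_of_real (map Re cs). [:- c, 1:])"
    unfolding real cs[symmetric] by (rule of_real_hom.char_poly_hom[OF A, symmetric])
  also have "\<dots> = map_poly complex_of_real (\<Prod>e\<leftarrow>map Re cs. [:- e, 1:])"
    by (simp add: h.hom_prod_list o_def)
  finally have "char_poly A = (\<Prod>e\<leftarrow>map Re cs. [:- e, 1:])"
    by simp
  with len show ?thesis
    by (intro exI[of _ "map Re cs"]) simp
qed

text \<open>Since the characteristic polynomial splits over the reals, listing only real roots loses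
  no eigenvalue, and the spectrum is \<open>sort es\<close>.\<close>

lemma ordered_spectrum_symmetric:
  assumes A: "A \<in> carrier_mat n n" and sym: "symmetric_mat A"
  shows "char_poly A = (\<Prod>e\<leftarrow>ordered_spectrum A. [:- e, 1:])"
    and "length (ordered_spectrum A) = n" and "sorted (ordered_spectrum A)"
proof -
  obtain es where es: "char_poly A = (\<Prod>e\<leftarrow>es. [:- e, 1:])" "length es = n"
    using symmetric_mat_char_poly_splits[OF assms] by blast
  have "proots (\<Prod>e\<leftarrow>es. [:- e, 1:]) = mset es"
  proof (induction es)
    case (Cons e es)
    have "(\<Prod>e\<leftarrow>es. [:- e, 1:]) \<noteq> (0 :: real poly)"
      by (auto simp: prod_list_zero_iff)
    then show ?case
      \<comment> \<open>Removing \<open>mult_pCons_left\<close> keeps the product in factored form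
        for \<open>proots_mult\<close>.\<close>
      using Cons by (simp add: proots_mult del: mult_pCons_left)
  qed simp
  then have os: "ordered_spectrum A = sort es"
    by (simp add: ordered_spectrum_def es)
  show "length (ordered_spectrum A) = n" "sorted (ordered_spectrum A)"
    using es by (simp_all add: os)
  have "(\<Prod>e\<leftarrow>sort es. [:- e, 1:]) = prod_mset (image_mset (\<lambda>e. [:- e, 1:]) (mset (sort es)))"
    by (simp only: mset_map prod_mset_prod_list flip: prod_mset_prod_list)
  also have "\<dots> = char_poly A"
    by (simp only: es mset_sort mset_map flip: prod_mset_prod_list)
  finally show "char_poly A = (\<Prod>e\<leftarrow>ordered_spectrum A. [:- e, 1:])"
    by (simp add: os)
qed

section \<open>Householder reflections and the spectral theorem\<close>

text \<open>\<open>H\<close> is the reflection in the hyperplane orthogonal to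
  \<open>v - unit_vec n 0\<close>. It exchanges these two unit vectors, and its first column is the
  image of \<open>unit_vec n 0\<close>.\<close>

lemma householder_exists:
  fixes v :: "real vec"
  assumes v: "v \<in> carrier_vec n" and norm: "v \<bullet> v = 1" and n: "0 < n"
  shows "\<exists>H \<in> carrier_mat n n. symmetric_mat H \<and> H * H = 1\<^sub>m n \<and> col H 0 = v"
proof -
  define u where "u i = v $ i - (if i = 0 then 1 else 0)" for i
  define s where "s = (\<Sum>i<n. u i * u i)"
  \<comment> \<open>If \<open>v\<close> is already \<open>unit_vec n 0\<close>, then
    \<open>s = 0\<close>; division by zero gives \<open>c = 0\<close>, and \<open>H\<close> is the
    identity.\<close>
  define c where "c = 2 / s"
  define H where "H = mat n n (\<lambda>(i, j). (if i = j then 1 else 0) - c * u i * u j)"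
  have H: "H \<in> carrier_mat n n"
    by (simp add: H_def)
  have "symmetric_mat H"
    by (rule symmetric_matI[OF H]) (auto simp: H_def)
  moreover have "H * H = 1\<^sub>m n"
  proof (rule eq_matI)
    fix i j assume "i < dim_row (1\<^sub>m n :: real mat)" "j < dim_col (1\<^sub>m n :: real mat)"
    then have ij: "i < n" "j < n" by auto
    have "(H * H) $$ (i, j) = (\<Sum>k<n. ((if i = k then 1 else 0) - c * u i * u k) *
        ((if k = j then 1 else 0) - c * u k * u j))"
      using ij by (simp add: H_def scalar_prod_def lessThan_atLeast0)
    also have "\<dots> = (\<Sum>k<n. (if i = k then (if k = j then 1 else 0) else 0)
        - (if i = k then c * u k * u j else 0) - (if k = j then c * u i * u k else 0)
        + c * c * u i * u j * (u k * u k))"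
      by (intro sum.cong) (auto simp: algebra_simps)
    also have "\<dots> = (if i = j then 1 else 0) - 2 * c * u i * u j + c * c * u i * u j * s"
      using ij by (simp add: sum.distrib sum_subtractf s_def sum_distrib_left)
    \<comment> \<open>The identity \<open>c * c * s = 2 * c\<close> holds for \<open>s = 0\<close>
      as well, since then \<open>c = 0\<close>.\<close>
    also have "\<dots> = (if i = j then 1 else 0)"
      by (simp add: c_def)
    finally show "(H * H) $$ (i, j) = 1\<^sub>m n $$ (i, j)"
      using ij by simp
  qed (use H in auto)
  moreover have "col H 0 = v"
  proof (rule eq_vecI)
    have norm': "(\<Sum>i<n. v $ i * v $ i) = 1"
      using norm scalar_prod_eq_sum[OF v] by simp
    \<comment> \<open>As \<open>v\<close> has norm 1, the expansion gives
      \<open>s = 2 - 2 * v $ 0\<close>. Hence \<open>c * u 0 = - 1\<close> unless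
      \<open>s = 0\<close>, in which case every \<open>u i\<close> vanishes.\<close>
    have "s = (\<Sum>i<n. v $ i * v $ i + (if i = 0 then 1 - 2 * v $ i else 0))"
      unfolding s_def u_def by (intro sum.cong) (auto simp: algebra_simps)
    then have "s = - 2 * u 0"
      using n by (simp add: sum.distrib norm' u_def)
    moreover have "u i = 0" if "s = 0" "i < n" for i
      using that by (auto simp: s_def sum_nonneg_eq_0_iff)
    ultimately have cu: "c * u 0 * u i = - u i" if "i < n" for i
      using that by (cases "s = 0") (auto simp: c_def)
    fix i assume "i < dim_vec v"
    with v have "i < n" by simp
    with n cu[OF this] show "col H 0 $ i = v $ i"
      by (simp add: H_def u_def algebra_simps)
  qed (use H v in simp)
  ultimately show ?thesis
    using H by blast
qed


text \<open>Deflation: a Householder reflection whose first column is a unit eigenvector for the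
  head of \<open>es\<close> splits off a block of size 1, and the induction hypothesis treats the
  remaining symmetric block. The list may be in any order and prescribes that of the diagonal, so
  the sorted spectrum can be inserted later.\<close>

theorem symmetric_mat_orthogonally_diagonalizable:
  fixes A :: "real mat"
  assumes "A \<in> carrier_mat n n" "symmetric_mat A" "char_poly A = (\<Prod>e\<leftarrow>es. [:- e, 1:])"
  shows "\<exists>V. similar_mat_wit A (mat_diag n ((!) es)) V (transpose_mat V)"
  using assms
proof (induction es arbitrary: n A)
  case Nil
  then have "n = 0"
    using degree_monic_char_poly[of A n] by simp
  with Nil show ?case
    by (intro exI[of _ "1\<^sub>m 0"] similar_mat_witI[of _ _ 0]) auto
next
  case (Cons e es n A)
  note A = Cons.prems(1) and sym = Cons.prems(2)
  have eig: "eigenvalue A e"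
    unfolding eigenvalue_root_char_poly[OF A] Cons.prems(3) by simp
  then obtain w where w: "w \<in> carrier_vec n" "w \<noteq> 0\<^sub>v n" "A *\<^sub>v w = e \<cdot>\<^sub>v w"
    using A by (auto simp: eigenvalue_def eigenvector_def)
  have "n \<noteq> 0"
    using w(1,2) by auto
  then obtain k where n: "n = 1 + k"
    by (metis One_nat_def add.commute not0_implies_Suc plus_1_eq_Suc)
  have "w \<bullet> w > 0"
    using w(1,2) by (rule scalar_prod_self_pos)
  define v where "v = (1 / sqrt (w \<bullet> w)) \<cdot>\<^sub>v w"
  have v: "v \<in> carrier_vec n" "v \<bullet> v = 1" "A *\<^sub>v v = e \<cdot>\<^sub>v v"
    using w \<open>w \<bullet> w > 0\<close> A
    by (auto simp: v_def mult_mat_vec[of _ n n] smult_smult_assoc mult.commute)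
  obtain H where H: "H \<in> carrier_mat n n" "symmetric_mat H" "H * H = 1\<^sub>m n" "col H 0 = v"
    using householder_exists[OF v(1,2)] n by auto
  have HT: "transpose_mat H = H"
    using H(2) by (simp add: symmetric_mat_def)
  define B where "B = H * A * H"
  have B: "B \<in> carrier_mat n n"
    using H A by (simp add: B_def)
  have AB: "similar_mat_wit A B H (transpose_mat H)"
  proof (rule similar_mat_witI[of _ _ n])
    have "H * B * H = (H * H) * A * (H * H)"
      using H(1) A by (simp add: B_def assoc_mult_mat[of _ n n _ n _ n])
    then show "A = H * B * transpose_mat H"
      using H A by (simp add: HT)
  qed (use H A B HT in auto)
  have "transpose_mat B = B"
    using H(1) A sym
    by (simp add: B_def HT transpose_mult[of _ n n _ n] symmetric_mat_def assoc_mult_mat[of _ n n _ n _ n])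
  then have symB: "symmetric_mat B"
    by (simp add: symmetric_mat_def)
  \<comment> \<open>\<open>H\<close> takes \<open>unit_vec n 0\<close> to the eigenvector
    \<open>v\<close> and, being an involution, takes \<open>v\<close> back; so
    \<open>unit_vec n 0\<close> is an eigenvector of \<open>B\<close>.\<close>
  have "col B 0 = (H * A) *\<^sub>v col H 0"
    unfolding B_def by (rule col_mult2[of _ n n]) (use H(1) A n in auto)
  also have "\<dots> = H *\<^sub>v (e \<cdot>\<^sub>v col H 0)"
    using assoc_mult_mat_vec[OF H(1) A v(1)] by (simp add: H(4) v(3))
  also have "\<dots> = e \<cdot>\<^sub>v (H *\<^sub>v col H 0)"
    using H(1) by (subst mult_mat_vec[of _ n n]) auto
  also have "H *\<^sub>v col H 0 = col (H * H) 0"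
    by (rule col_mult2[of _ n n, symmetric]) (use H(1) n in auto)
  also have "\<dots> = unit_vec n 0"
    using n by (simp add: H(3))
  finally have col0: "col B 0 = e \<cdot>\<^sub>v unit_vec n 0" .
  have B0: "B $$ (i, 0) = (if i = 0 then e else 0)" if "i < n" for i
    using arg_cong[OF col0, of "\<lambda>x. x $ i"] that B n by (auto simp: unit_vec_def)
  define C where "C = mat k k (\<lambda>(i, j). B $$ (i + 1, j + 1))"
  have C: "C \<in> carrier_mat k k"
    by (simp add: C_def)
  have symC: "symmetric_mat C"
    using symmetric_mat_index[OF symB B] n by (intro symmetric_matI[OF C]) (auto simp: C_def)
  let ?E = "mat 1 1 (\<lambda>_. e)"
  \<comment> \<open>Column 0 is given by \<open>B0\<close>; symmetry of \<open>B\<close> then clears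
    row 0 too.\<close>
  have block: "B = four_block_mat ?E (0\<^sub>m 1 k) (0\<^sub>m k 1) C"
  proof (rule eq_matI)
    fix i j
    assume "i < dim_row (four_block_mat ?E (0\<^sub>m 1 k) (0\<^sub>m k 1) C)"
      and "j < dim_col (four_block_mat ?E (0\<^sub>m 1 k) (0\<^sub>m k 1) C)"
    then have ij: "i < n" "j < n"
      using C n by auto
    show "B $$ (i, j) = four_block_mat ?E (0\<^sub>m 1 k) (0\<^sub>m k 1) C $$ (i, j)"
      using ij n B0[OF ij(1)] B0[OF ij(2)] symmetric_mat_index[OF symB B ij]
      by (auto simp: C_def)
  qed (use B C n in auto)
  have "char_poly A = char_poly B"
    using AB by (intro char_poly_similar) (auto simp: similar_mat_def)
  also have "\<dots> = char_poly ?E * char_poly C"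
    unfolding block by (rule char_poly_four_block_zeros_col) (use C in auto)
  also have "char_poly ?E = [:- e, 1:]"
    by (simp add: char_poly_defs det_def sign_def)
  finally have "[:- e, 1:] * char_poly C = [:- e, 1:] * (\<Prod>e\<leftarrow>es. [:- e, 1:])"
    using Cons.prems(3) by (simp del: mult_pCons_left)
  then have "char_poly C = (\<Prod>e\<leftarrow>es. [:- e, 1:])"
    by (metis mult_cancel_left pCons_eq_0_iff zero_neq_one)
  from Cons.IH[OF C symC this] obtain W
    where W: "similar_mat_wit C (mat_diag k ((!) es)) W (transpose_mat W)" ..
  note W' = similar_mat_witD2[OF C W]
  let ?W = "four_block_mat (1\<^sub>m 1) (0\<^sub>m 1 k) (0\<^sub>m k 1) W"
  have "similar_mat_wit B (four_block_mat ?E (0\<^sub>m 1 k) (0\<^sub>m k 1) (mat_diag k ((!) es)))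
      ?W (four_block_mat (1\<^sub>m 1) (0\<^sub>m 1 k) (0\<^sub>m k 1) (transpose_mat W))"
    unfolding block
    by (rule similar_mat_wit_four_block[OF similar_mat_wit_refl W]) (use C W' in auto)
  moreover have "four_block_mat ?E (0\<^sub>m 1 k) (0\<^sub>m k 1) (mat_diag k ((!) es))
      = mat_diag n ((!) (e # es))"
    by (rule eq_matI) (auto simp: mat_diag_def n nth_Cons')
  moreover have "four_block_mat (1\<^sub>m 1) (0\<^sub>m 1 k) (0\<^sub>m k 1) (transpose_mat W) = transpose_mat ?W"
    using W'(6) by (subst transpose_four_block_mat) auto
  ultimately have "similar_mat_wit B (mat_diag n ((!) (e # es))) ?W (transpose_mat ?W)"
    by simp
  from similar_mat_wit_trans[OF AB this]
  have "similar_mat_wit A (mat_diag n ((!) (e # es))) (H * ?W) (transpose_mat ?W * transpose_mat H)" .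
  also have "transpose_mat ?W * transpose_mat H = transpose_mat (H * ?W)"
    using H(1) W'(6) n by (subst transpose_mult[of _ n n _ n]) auto
  finally show ?case ..
qed

section \<open>Test vectors of Courant-Fischer type\<close>

text \<open>Padding \<open>ws\<close> with at least one zero vector gives a square matrix whose last
  row is zero. It is singular, and any nonzero kernel vector serves.\<close>

lemma exists_orthogonal_vec:
  fixes ws :: "real vec list"
  assumes "length ws < n" "set ws \<subseteq> carrier_vec n"
  shows "\<exists>x \<in> carrier_vec n. x \<noteq> 0\<^sub>v n \<and> (\<forall>w \<in> set ws. w \<bullet> x = 0)"
proof -
  define M where "M = mat_of_rows n (ws @ replicate (n - length ws) (0\<^sub>v n))"
  have M: "M \<in> carrier_mat n n"
    using assms by (simp add: M_def mat_of_rows_def)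
  have row: "row M i = (ws @ replicate (n - length ws) (0\<^sub>v n)) ! i" if "i < n" for i
    unfolding M_def using that assms by (intro mat_of_rows_row) (auto simp: nth_append)
  have "row M (n - 1) = 0\<^sub>v n"
    using assms nth_append_right[of ws "n - 1"] by (simp add: row)
  then have "M $$ (n - 1, j) = 0" if "j < n" for j
    using that assms M by (metis carrier_matD diff_less gr_implies_not0 index_row(1)
        index_zero_vec(1) less_one nat_neq_iff)
  then have "det M = 0"
    using laplace_expansion_row[OF M, of "n - 1"] assms by simp
  then obtain x where x: "x \<in> carrier_vec n" "x \<noteq> 0\<^sub>v n" "M *\<^sub>v x = 0\<^sub>v n"
    using det_0_iff_vec_prod_zero[OF M] by blast
  have "ws ! i \<bullet> x = 0" if "i < length ws" for i
    using arg_cong[OF x(3), of "\<lambda>y. y $ i"] that assms M row[of i] by (auto simp: nth_append)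
  with x show ?thesis
    by (metis in_set_conv_nth)
qed

text \<open>The columns of \<open>V\<close> form an orthonormal eigenbasis, and \<open>y\<close>
  holds the coordinates of \<open>x\<close> in it; the second identity is Parseval's.\<close>

lemma orthogonal_diagonalization_quadratic_form:
  fixes A :: "real mat"
  assumes A: "A \<in> carrier_mat n n"
    and wit: "similar_mat_wit A (mat_diag n d) V (transpose_mat V)"
    and x: "x \<in> carrier_vec n"
  shows "x \<bullet> (A *\<^sub>v x) = (\<Sum>i<n. d i * (col V i \<bullet> x)\<^sup>2)"
    and "x \<bullet> x = (\<Sum>i<n. (col V i \<bullet> x)\<^sup>2)"
proof -
  note W = similar_mat_witD2[OF A wit]
  have V: "V \<in> carrier_mat n n"
    by (rule W)
  define y where "y = transpose_mat V *\<^sub>v x"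
  have y: "y \<in> carrier_vec n"
    using V x by (simp add: y_def)
  have yi: "y $ i = col V i \<bullet> x" if "i < n" for i
    using that V by (simp add: y_def)
  have xV: "x \<bullet> (V *\<^sub>v z) = y \<bullet> z" if "z \<in> carrier_vec n" for z
    unfolding y_def using V x that
    by (metis transpose_vec_mult_scalar comm_scalar_prod mult_mat_vec_carrier transpose_carrier_mat)
  have "x \<bullet> x = x \<bullet> (V *\<^sub>v y)"
    using V x W(1) by (simp add: y_def flip: assoc_mult_mat_vec[of V n n _ n])
  also have "\<dots> = (\<Sum>i<n. (col V i \<bullet> x)\<^sup>2)"
    by (simp add: xV[OF y] scalar_prod_eq_sum[OF y] yi power2_eq_square)
  finally show "x \<bullet> x = (\<Sum>i<n. (col V i \<bullet> x)\<^sup>2)" .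
  let ?D = "mat_diag n d"
  have "A *\<^sub>v x = V *\<^sub>v (?D *\<^sub>v y)"
    unfolding W(3) y_def using V x
    by (simp add: assoc_mult_mat_vec[of _ n n _ n] mult_carrier_mat[of _ n n _ n])
  then have "x \<bullet> (A *\<^sub>v x) = y \<bullet> (?D *\<^sub>v y)"
    using y by (simp add: xV mult_mat_vec_carrier[of _ n n])
  also have "\<dots> = (\<Sum>i<n. y $ i * (\<Sum>j<n. ?D $$ (i, j) * y $ j))"
    using y mult_mat_vec_index_sum[of ?D n y]
    by (subst scalar_prod_eq_sum[of _ n]) (auto intro: mult_mat_vec_carrier[of _ n n])
  also have "\<dots> = (\<Sum>i<n. d i * (col V i \<bullet> x)\<^sup>2)"
  proof (intro sum.cong refl)
    fix i assume "i \<in> {..<n}"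
    then have "(\<Sum>j<n. ?D $$ (i, j) * y $ j) = (\<Sum>j<n. if j = i then d i * y $ i else 0)"
      by (intro sum.cong) (auto simp: mat_diag_def)
    with \<open>i \<in> {..<n}\<close> show "y $ i * (\<Sum>j<n. ?D $$ (i, j) * y $ j) = d i * (col V i \<bullet> x)\<^sup>2"
      by (simp add: yi power2_eq_square)
  qed
  finally show "x \<bullet> (A *\<^sub>v x) = (\<Sum>i<n. d i * (col V i \<bullet> x)\<^sup>2)" .
qed

text \<open>The dimension count behind Courant--Fischer: fewer than \<open>n\<close> linear conditions put \<open>x\<close> into
  the span of the eigenvectors of \<open>A\<close> from position \<open>p\<close> on, into the span of those of \<open>B\<close> up to
  position \<open>q\<close>, and into the orthogonal complement of \<open>ws\<close>.\<close>

lemma ordered_spectrum_test_vec: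
  fixes A B :: "real mat"
  assumes A: "A \<in> carrier_mat n n" "symmetric_mat A" and B: "B \<in> carrier_mat n n" "symmetric_mat B"
    and ws: "set ws \<subseteq> carrier_vec n" and pq: "p + length ws \<le> q" "q < n"
  shows "\<exists>x \<in> carrier_vec n. 0 < x \<bullet> x \<and> (\<forall>w \<in> set ws. w \<bullet> x = 0) \<and>
    ordered_spectrum A ! p * (x \<bullet> x) \<le> x \<bullet> (A *\<^sub>v x) \<and>
    x \<bullet> (B *\<^sub>v x) \<le> ordered_spectrum B ! q * (x \<bullet> x)"
proof -
  note sA = ordered_spectrum_symmetric[OF A] and sB = ordered_spectrum_symmetric[OF B]
  obtain V where V: "similar_mat_wit A (mat_diag n ((!) (ordered_spectrum A))) V (transpose_mat V)"
    using symmetric_mat_orthogonally_diagonalizable[OF A sA(1)] ..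
  obtain W where W: "similar_mat_wit B (mat_diag n ((!) (ordered_spectrum B))) W (transpose_mat W)"
    using symmetric_mat_orthogonally_diagonalizable[OF B sB(1)] ..
  let ?ws = "ws @ map (col V) [0..<p] @ map (col W) [Suc q..<n]"
  have "set ?ws \<subseteq> carrier_vec n"
    using ws similar_mat_witD2(6)[OF A(1) V] similar_mat_witD2(6)[OF B(1) W] by auto
  \<comment> \<open>There are \<open>length ws + p + (n - 1 - q)\<close> conditions, at most
    \<open>n - 1\<close> because \<open>p + length ws \<le> q\<close>.\<close>
  moreover have "length ?ws < n"
    using pq by simp
  ultimately obtain x where x: "x \<in> carrier_vec n" "x \<noteq> 0\<^sub>v n" "\<forall>w \<in> set ?ws. w \<bullet> x = 0"
    using exists_orthogonal_vec[of ?ws n] by blast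
  note qA = orthogonal_diagonalization_quadratic_form[OF A(1) V x(1)]
  note qB = orthogonal_diagonalization_quadratic_form[OF B(1) W x(1)]
  \<comment> \<open>Coordinates before position \<open>p\<close> vanish by the choice of
    \<open>x\<close>; from \<open>p\<close> on, sortedness bounds the eigenvalues from
    below.\<close>
  have "ordered_spectrum A ! p * (x \<bullet> x) \<le> x \<bullet> (A *\<^sub>v x)"
    unfolding qA sum_distrib_left
  proof (rule sum_mono)
    fix i assume i: "i \<in> {..<n}"
    show "ordered_spectrum A ! p * (col V i \<bullet> x)\<^sup>2 \<le> ordered_spectrum A ! i * (col V i \<bullet> x)\<^sup>2"
    proof (cases "i < p")
      case True
      then show ?thesis using x(3) by simp
    next
      case False
      with i sA(2,3) show ?thesis
        by (intro mult_right_mono) (auto intro: sorted_nth_mono)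
    qed
  qed
  moreover have "x \<bullet> (B *\<^sub>v x) \<le> ordered_spectrum B ! q * (x \<bullet> x)"
    unfolding qB sum_distrib_left
  proof (rule sum_mono)
    fix i assume i: "i \<in> {..<n}"
    show "ordered_spectrum B ! i * (col W i \<bullet> x)\<^sup>2 \<le> ordered_spectrum B ! q * (col W i \<bullet> x)\<^sup>2"
    proof (cases "q < i")
      case True
      with i have "col W i \<in> set ?ws" by auto
      with x(3) show ?thesis by simp
    next
      case False
      with i sB(2,3) pq show ?thesis
        by (intro mult_right_mono) (auto intro: sorted_nth_mono)
    qed
  qed
  moreover have "0 < x \<bullet> x"
    using x(1,2) by (rule scalar_prod_self_pos)
  ultimately show ?thesis
    using x by auto
qed


section \<open>Quadratic form of the net-Laplacian\<close>

text \<open>The edges at \<open>us ! i\<close> correspond bijectively to the indices of its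
  neighbours. Consequently every row of the net-Laplacian sums to zero.\<close>

lemma sdeg_eq_row_sum:
  assumes G: "signed_graph \<Gamma>" and us: "enumerates us \<Gamma>" and i: "i < length us"
  shows "real_of_int (sdeg \<Gamma> (us ! i)) = (\<Sum>j<length us. adj_matrix \<Gamma> us $$ (i, j))"
proof -
  let ?u = "us ! i" and ?J = "{j. j < length us \<and> {us ! i, us ! j} \<in> edges \<Gamma>}"
  define E where "E = {e \<in> edges \<Gamma>. ?u \<in> e}"
  have dist: "distinct us" and set: "set us = verts \<Gamma>"
    using us by (auto simp: enumerates_def)
  have "edges \<Gamma> \<subseteq> Pow (verts \<Gamma>)" "finite (verts \<Gamma>)"
    using G by (auto simp: signed_graph_def)
  then have "finite E"
    unfolding E_def by (auto intro: finite_subset[of _ "Pow (verts \<Gamma>)"])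
  have sgn: "sgn_of \<Gamma> e = 1 \<or> sgn_of \<Gamma> e = - 1" if "e \<in> E" for e
    using G that by (auto simp: signed_graph_def E_def)
  have "{e \<in> edges \<Gamma>. ?u \<in> e \<and> sgn_of \<Gamma> e = s} = {e \<in> E. sgn_of \<Gamma> e = s}" for s
    by (auto simp: E_def)
  then have "sdeg \<Gamma> ?u = (\<Sum>e\<in>E. if sgn_of \<Gamma> e = 1 then 1 else 0)
      - (\<Sum>e\<in>E. if sgn_of \<Gamma> e = - 1 then 1 else 0)"
    using \<open>finite E\<close> by (simp add: sdeg_def pos_deg_def neg_deg_def flip: sum.inter_filter)
  also have "\<dots> = (\<Sum>e\<in>E. sgn_of \<Gamma> e)"
    unfolding sum_subtractf[symmetric] using sgn by (intro sum.cong) auto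
  also have "\<dots> = (\<Sum>j\<in>?J. sgn_of \<Gamma> {?u, us ! j})"
  proof (rule sum.reindex_bij_betw[symmetric])
    have "inj_on (\<lambda>j. {?u, us ! j}) ?J"
      using dist by (auto simp: inj_on_def doubleton_eq_iff nth_eq_iff_index_eq i)
    moreover have "e \<in> (\<lambda>j. {?u, us ! j}) ` ?J" if "e \<in> E" for e
    proof -
      have "card e = 2" "?u \<in> e" "e \<subseteq> verts \<Gamma>" "e \<in> edges \<Gamma>"
        using that G by (auto simp: signed_graph_def E_def)
      then obtain b where "e = {?u, b}"
        by (auto simp: card_2_iff)
      moreover from this \<open>e \<subseteq> verts \<Gamma>\<close> obtain j where "j < length us" "b = us ! j"
        by (metis in_set_conv_nth insert_subset set)
      ultimately show ?thesis
        using \<open>e \<in> edges \<Gamma>\<close> by auto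
    qed
    ultimately show "bij_betw (\<lambda>j. {?u, us ! j}) ?J E"
      by (auto simp: bij_betw_def E_def)
  qed
  finally have "real_of_int (sdeg \<Gamma> ?u) = (\<Sum>j\<in>?J. real_of_int (sgn_of \<Gamma> {?u, us ! j}))"
    by simp
  also have "\<dots> = (\<Sum>j<length us. adj_matrix \<Gamma> us $$ (i, j))"
    using i by (intro sum.mono_neutral_cong_left) (auto simp: adj_matrix_def)
  finally show ?thesis .
qed

lemma adj_matrix_carrier: "adj_matrix \<Gamma> us \<in> carrier_mat (length us) (length us)"
  by (simp add: adj_matrix_def)

lemma adj_matrix_commute:
  assumes "i < length us" "j < length us"
  shows "adj_matrix \<Gamma> us $$ (i, j) = adj_matrix \<Gamma> us $$ (j, i)"
  using assms by (simp add: adj_matrix_def insert_commute)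

lemma net_laplacian_carrier: "net_laplacian \<Gamma> us \<in> carrier_mat (length us) (length us)"
  by (simp add: net_laplacian_def sdeg_matrix_def minus_carrier_mat[OF adj_matrix_carrier])

lemma net_laplacian_index:
  assumes "i < length us" "j < length us"
  shows "net_laplacian \<Gamma> us $$ (i, j) =
    (if i = j then real_of_int (sdeg \<Gamma> (us ! i)) else 0) - adj_matrix \<Gamma> us $$ (i, j)"
  using assms by (simp add: net_laplacian_def sdeg_matrix_def mat_diag_def adj_matrix_def)

lemma net_laplacian_symmetric: "symmetric_mat (net_laplacian \<Gamma> us)"
  by (rule symmetric_matI[OF net_laplacian_carrier])
    (simp add: net_laplacian_index adj_matrix_commute)

text \<open>The diagonal entries are the row sums of the adjacency matrix, so the operator acts
  through the differences \<open>x $ i - x $ j\<close>; averaging over both orders of a pair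
  produces squares. The double sum meets each edge twice, hence the division by 2.\<close>

lemma net_laplacian_quadratic_form:
  assumes G: "signed_graph \<Gamma>" and us: "enumerates us \<Gamma>" and x: "x \<in> carrier_vec (length us)"
  shows "x \<bullet> (net_laplacian \<Gamma> us *\<^sub>v x) =
    (\<Sum>i<length us. \<Sum>j<length us. adj_matrix \<Gamma> us $$ (i, j) * (x $ i - x $ j)\<^sup>2) / 2"
proof -
  let ?m = "length us" and ?a = "\<lambda>i j. adj_matrix \<Gamma> us $$ (i, j)"
  have "(net_laplacian \<Gamma> us *\<^sub>v x) $ i = (\<Sum>j<?m. ?a i j * (x $ i - x $ j))" if i: "i < ?m" for i
  proof -
    have "(net_laplacian \<Gamma> us *\<^sub>v x) $ i = (\<Sum>j<?m. net_laplacian \<Gamma> us $$ (i, j) * x $ j)"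
      by (rule mult_mat_vec_index_sum[OF net_laplacian_carrier x i])
    also have "\<dots> = (\<Sum>j<?m. (if i = j then sdeg \<Gamma> (us ! i) * x $ i else 0) - ?a i j * x $ j)"
      using i by (intro sum.cong) (auto simp: net_laplacian_index algebra_simps)
    also have "\<dots> = (\<Sum>j<?m. ?a i j) * x $ i - (\<Sum>j<?m. ?a i j * x $ j)"
      using i by (simp add: sum_subtractf sdeg_eq_row_sum[OF G us i])
    also have "\<dots> = (\<Sum>j<?m. ?a i j * (x $ i - x $ j))"
      by (simp add: right_diff_distrib sum_subtractf sum_distrib_right)
    finally show ?thesis .
  qed
  moreover have "net_laplacian \<Gamma> us *\<^sub>v x \<in> carrier_vec ?m"
    using mult_mat_vec_carrier[OF net_laplacian_carrier x] .
  ultimately have q: "x \<bullet> (net_laplacian \<Gamma> us *\<^sub>v x) =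
      (\<Sum>i<?m. \<Sum>j<?m. ?a i j * (x $ i - x $ j) * x $ i)"
    by (simp add: scalar_prod_eq_sum sum_distrib_left mult_ac)
  also have "\<dots> = (\<Sum>j<?m. \<Sum>i<?m. ?a i j * (x $ i - x $ j) * x $ i)"
    by (rule sum.swap)
  \<comment> \<open>After renaming the indices, the adjacency entry is unchanged while the
    difference changes sign.\<close>
  also have "\<dots> = (\<Sum>i<?m. \<Sum>j<?m. - (?a i j * (x $ i - x $ j) * x $ j))"
    by (intro sum.cong refl) (auto simp: adj_matrix_commute algebra_simps)
  finally have "2 * (x \<bullet> (net_laplacian \<Gamma> us *\<^sub>v x)) =
      (\<Sum>i<?m. \<Sum>j<?m. ?a i j * (x $ i - x $ j) * x $ i)
      + (\<Sum>i<?m. \<Sum>j<?m. - (?a i j * (x $ i - x $ j) * x $ j))"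
    using q by linarith
  also have "\<dots> = (\<Sum>i<?m. \<Sum>j<?m. ?a i j * (x $ i - x $ j)\<^sup>2)"
    unfolding sum.distrib[symmetric]
    by (intro sum.cong refl) (simp add: power2_eq_square algebra_simps)
  finally show ?thesis
    by simp
qed

text \<open>Each sign is at most \<open>1\<close>, so the form is dominated by that of the Laplacian of the complete
  graph, which is \<open>m (x \<bullet> x) - (\<Sum>i<m. x\<^sub>i)\<^sup>2\<close>.\<close>

lemma net_laplacian_quadratic_form_le:
  assumes G: "signed_graph \<Gamma>" and us: "enumerates us \<Gamma>" and x: "x \<in> carrier_vec (length us)"
  shows "x \<bullet> (net_laplacian \<Gamma> us *\<^sub>v x) \<le> real (length us) * (x \<bullet> x)"
proof -
  let ?m = "length us"
  have "adj_matrix \<Gamma> us $$ (i, j) \<le> 1" if "i < ?m" "j < ?m" for i j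
    using G that by (auto simp: adj_matrix_def signed_graph_def)
  then have "adj_matrix \<Gamma> us $$ (i, j) * (x $ i - x $ j)\<^sup>2 \<le> (x $ i - x $ j)\<^sup>2"
    if "i < ?m" "j < ?m" for i j
    using that mult_right_mono[of _ 1 "(x $ i - x $ j)\<^sup>2"] by simp
  then have "(\<Sum>i<?m. \<Sum>j<?m. adj_matrix \<Gamma> us $$ (i, j) * (x $ i - x $ j)\<^sup>2)
      \<le> (\<Sum>i<?m. \<Sum>j<?m. (x $ i - x $ j)\<^sup>2)"
    by (intro sum_mono) simp
  also have "\<dots> = (\<Sum>i<?m. \<Sum>j<?m. x $ i * x $ i + x $ j * x $ j - 2 * (x $ i * x $ j))"
    by (intro sum.cong refl) (simp add: power2_eq_square algebra_simps)
  also have "\<dots> = 2 * real ?m * (x \<bullet> x) - 2 * (\<Sum>i<?m. x $ i)\<^sup>2"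
    by (simp add: sum.distrib sum_subtractf scalar_prod_eq_sum[OF x] power2_eq_square sum_product
        flip: sum_distrib_left)
  also have "\<dots> \<le> 2 * real ?m * (x \<bullet> x)"
    by simp
  finally show ?thesis
    by (simp add: net_laplacian_quadratic_form[OF G us x])
qed

section \<open>Removal of a negative edge and interlacing\<close>

lemma adj_matrix_remove_negative_edge:
  assumes "e \<in> edges \<Gamma>" "sgn_of \<Gamma> e = - 1" "i < length us" "j < length us"
  shows "adj_matrix (remove_edge \<Gamma> e) us $$ (i, j) =
    adj_matrix \<Gamma> us $$ (i, j) + (if {us ! i, us ! j} = e then 1 else 0)"
  using assms by (auto simp: adj_matrix_def remove_edge_def)

text \<open>The entries \<open>- 1\<close> of \<open>e\<close> become 0 and so rise by 1. Both
  orders of the end vertices occur in the double sum, so its half is a single squared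
  difference.\<close>

lemma remove_negative_edge_quadratic_form:
  assumes G: "signed_graph \<Gamma>" and us: "enumerates us \<Gamma>" and x: "x \<in> carrier_vec (length us)"
    and e: "e \<in> edges \<Gamma>" "sgn_of \<Gamma> e = - 1"
  shows "x \<bullet> (net_laplacian (remove_edge \<Gamma> e) us *\<^sub>v x) = x \<bullet> (net_laplacian \<Gamma> us *\<^sub>v x) +
    (\<Sum>i<length us. \<Sum>j<length us. if {us ! i, us ! j} = e then (x $ i - x $ j)\<^sup>2 else 0) / 2"
proof -
  have us': "enumerates us (remove_edge \<Gamma> e)"
    using us by (simp add: enumerates_def remove_edge_def)
  have "(\<Sum>i<length us. \<Sum>j<length us. adj_matrix (remove_edge \<Gamma> e) us $$ (i, j) * (x $ i - x $ j)\<^sup>2)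
    = (\<Sum>i<length us. \<Sum>j<length us. adj_matrix \<Gamma> us $$ (i, j) * (x $ i - x $ j)\<^sup>2
        + (if {us ! i, us ! j} = e then (x $ i - x $ j)\<^sup>2 else 0))"
    by (intro sum.cong refl) (auto simp: adj_matrix_remove_negative_edge[OF e] algebra_simps)
  then show ?thesis
    by (simp add: net_laplacian_quadratic_form[OF G us x] sum.distrib add_divide_distrib
        net_laplacian_quadratic_form[OF signed_graph_remove_edge[OF G] us' x])
qed

theorem theorem3p2:
  fixes \<Gamma> :: "'a sgraph" and us :: "'a list" and e :: "'a set"
    and m :: nat and \<alpha> \<beta> :: "real list"
  assumes "signed_graph \<Gamma>"
    and "card (verts \<Gamma>) = m"
    and "enumerates us \<Gamma>"
    and "e \<in> edges \<Gamma>"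
    and "sgn_of \<Gamma> e = - 1"
    and "\<alpha> = ordered_spectrum (net_laplacian \<Gamma> us)"
    and "\<beta> = ordered_spectrum (net_laplacian (remove_edge \<Gamma> e) us)"
  shows "length \<alpha> = m \<and> length \<beta> = m \<and>
    (\<forall>p \<in> {1..m}. \<alpha> ! (p - 1) \<le> \<beta> ! (p - 1) \<and> \<beta> ! (p - 1) \<le> (\<alpha> @ [real m]) ! p)"
proof -
  note G = assms(1) and us = assms(3) and e = assms(4,5)
  note G' = signed_graph_remove_edge[OF G, of e]
  have us': "enumerates us (remove_edge \<Gamma> e)"
    using us by (simp add: enumerates_def remove_edge_def)
  have m: "length us = m"
    using us assms(2) by (metis distinct_card enumerates_def)
  let ?A = "net_laplacian \<Gamma> us" and ?B = "net_laplacian (remove_edge \<Gamma> e) us"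
  note cA = net_laplacian_carrier[of \<Gamma> us, unfolded m] net_laplacian_symmetric[of \<Gamma> us]
  note cB = net_laplacian_carrier[of "remove_edge \<Gamma> e" us, unfolded m]
    net_laplacian_symmetric[of "remove_edge \<Gamma> e" us]
  note quad = remove_negative_edge_quadratic_form[OF G us _ e, unfolded m]
  have len: "length \<alpha> = m" "length \<beta> = m"
    using ordered_spectrum_symmetric(2)[OF cA] ordered_spectrum_symmetric(2)[OF cB] assms(6,7)
    by auto
  \<comment> \<open>Without side conditions both spectra can be tested at the same position
    \<open>p\<close>.\<close>
  have lower: "\<alpha> ! p \<le> \<beta> ! p" if p: "p < m" for p
  proof -
    obtain x where x: "x \<in> carrier_vec m" "0 < x \<bullet> x"
      "\<alpha> ! p * (x \<bullet> x) \<le> x \<bullet> (?A *\<^sub>v x)" "x \<bullet> (?B *\<^sub>v x) \<le> \<beta> ! p * (x \<bullet> x)"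
      using ordered_spectrum_test_vec[OF cA cB, of "[]" p p] p assms(6,7) by auto
    have "x \<bullet> (?A *\<^sub>v x) \<le> x \<bullet> (?B *\<^sub>v x)"
      using quad[OF x(1)] by (simp add: sum_nonneg)
    with x have "\<alpha> ! p * (x \<bullet> x) \<le> \<beta> ! p * (x \<bullet> x)"
      by linarith
    with x(2) show ?thesis
      by simp
  qed
  have upper: "\<beta> ! p \<le> \<alpha> ! Suc p" if p: "Suc p < m" for p
  proof -
    have "card e = 2" "e \<subseteq> set us"
      using G e us by (auto simp: signed_graph_def enumerates_def)
    then obtain k l where kl: "e = {us ! k, us ! l}" "k < m" "l < m"
      by (auto simp: card_2_iff in_set_conv_nth m)
    \<comment> \<open>Orthogonality to \<open>?w\<close> means \<open>x $ k = x $ l\<close>, so the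
      added squares vanish. This one condition costs one position, hence \<open>Suc p\<close> on the
      side of \<open>?A\<close>.\<close>
    let ?w = "unit_vec m k - unit_vec m l :: real vec"
    obtain x where x: "x \<in> carrier_vec m" "0 < x \<bullet> x" "?w \<bullet> x = 0"
      "\<beta> ! p * (x \<bullet> x) \<le> x \<bullet> (?B *\<^sub>v x)" "x \<bullet> (?A *\<^sub>v x) \<le> \<alpha> ! Suc p * (x \<bullet> x)"
      using ordered_spectrum_test_vec[OF cB cA, of "[?w]" p "Suc p"] p assms(6,7) by auto
    have "x $ k = x $ l"
      using x(1,3) kl by (simp add: minus_scalar_prod_distrib[of _ m])
    moreover have "(i = k \<and> j = l) \<or> (i = l \<and> j = k)" if "{us ! i, us ! j} = e" "i < m" "j < m" for i j
      using that kl us m by (auto simp: doubleton_eq_iff enumerates_def nth_eq_iff_index_eq)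
    ultimately have "(\<Sum>i<m. \<Sum>j<m. if {us ! i, us ! j} = e then (x $ i - x $ j)\<^sup>2 else 0) = 0"
      by (intro sum.neutral ballI) fastforce
    with quad[OF x(1)] x(4,5) have "\<beta> ! p * (x \<bullet> x) \<le> \<alpha> ! Suc p * (x \<bullet> x)"
      by simp
    with x(2) show ?thesis
      by simp
  qed
  have top: "\<beta> ! p \<le> real m" if p: "p < m" for p
  proof -
    \<comment> \<open>With \<open>?B\<close> in both roles, only the lower bound on its form is
      kept, to be set against the bound by \<open>m\<close> valid for all vectors.\<close>
    obtain x where x: "x \<in> carrier_vec m" "0 < x \<bullet> x" "\<beta> ! p * (x \<bullet> x) \<le> x \<bullet> (?B *\<^sub>v x)"
      using ordered_spectrum_test_vec[OF cB cB, of "[]" p p] p assms(7) by auto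
    have "x \<bullet> (?B *\<^sub>v x) \<le> real m * (x \<bullet> x)"
      using net_laplacian_quadratic_form_le[OF G' us'] x(1) m by simp
    with x(3) have "\<beta> ! p * (x \<bullet> x) \<le> real m * (x \<bullet> x)"
      by (rule order_trans)
    with x(2) show ?thesis
      by simp
  qed
  \<comment> \<open>Lists are indexed from 0, so entry \<open>p\<close> of
    \<open>\<alpha> @ [real m]\<close> is eigenvalue number \<open>p + 1\<close>. For
    \<open>p = m\<close> it is the appended \<open>real m\<close>, and \<open>top\<close> takes the
    place of \<open>upper\<close>.\<close>
  have "\<alpha> ! (p - 1) \<le> \<beta> ! (p - 1) \<and> \<beta> ! (p - 1) \<le> (\<alpha> @ [real m]) ! p" if "p \<in> {1..m}" for p
    using that lower[of "p - 1"] upper[of "p - 1"] top[of "p - 1"] len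
    by (cases "p = m") (auto simp: nth_append)
  with len show ?thesis
    by blast
qed

end
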